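(* Let $E=(\mathbb{C}^2,\|\cdot\|_\infty)$, so that $B_E=\mathbf{D}^2$ is the bidisc. Then $\mathcal{B}_{inv}(\mathbf{D}^2)\subsetneq\mathcal{B}_{nat}(\mathbf{D}^2)$.
   Context: $\mathbf{D}$ is the open unit disk of $\mathbb{C}$. For a complex Banach space $E$ with open unit ball $B_E$, $H(B_E)$ is the space of holomorphic (complex Fréchet differentiable) functions $f:B_E\to\mathbb{C}$, and $Aut(B_E)$ is the set of all biholomorphic bijections $\phi:B_E\to B_E$. For $f\in H(B_E)$ put $\|f\|_{nat}=\sup_{x\in B_E}(1-\|x\|^2)\|f'(x)\|$ and $\|f\|_{inv}=\sup_{\phi\in Aut(B_E)}\|(f\circ\phi)'(0)\|$ (derivatives are in $E^*$, with the dual norm). Define $\mathcal{B}_{nat}(B_E)=\{f\in H(B_E):\|f\|_{nat}<\infty\}$ and $\mathcal{B}_{inv}(B_E)=\{f\in H(B_E):\|f\|_{inv}<\infty\}$. *)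

theory Defs
  imports "HOL-Analysis.Analysis"
begin

section \<open>Complex Banach spaces\<close>

class complex_banach = banach +
  fixes scaleC :: "complex \<Rightarrow> 'a \<Rightarrow> 'a"  (infixr "*\<^sub>C" 75)
  assumes scaleC_add_right: "c *\<^sub>C (x + y) = c *\<^sub>C x + c *\<^sub>C y"
    and scaleC_add_left: "(c + d) *\<^sub>C x = c *\<^sub>C x + d *\<^sub>C x"
    and scaleC_scaleC: "c *\<^sub>C d *\<^sub>C x = (c * d) *\<^sub>C x"
    and scaleC_of_real: "complex_of_real r *\<^sub>C x = r *\<^sub>R x"
    and norm_scaleC: "norm (c *\<^sub>C x) = cmod c * norm x"

lemma vector_space_scaleC: "vector_space (scaleC :: complex \<Rightarrow> 'a \<Rightarrow> 'a::complex_banach)"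
  using scaleC_of_real[of 1]
  by unfold_locales (simp_all add: scaleC_add_right scaleC_add_left scaleC_scaleC)

instantiation complex :: complex_banach
begin

definition scaleC_complex :: "complex \<Rightarrow> complex \<Rightarrow> complex"
  where "scaleC_complex = (*)"

instance
  by standard (simp_all add: scaleC_complex_def algebra_simps norm_mult scaleR_conv_of_real)

end

section \<open>Holomorphic maps and automorphisms of the unit ball\<close>

text \<open>Holomorphy is complex Frechet differentiability: the derivative, a bounded real-linear
  map, is required to be complex-linear. It is only used on open sets, where the full
  neighbourhood filter is the right one.\<close>

definition frechet_holomorphic_on ::
    "('a::complex_banach \<Rightarrow> 'b::complex_banach) \<Rightarrow> 'a set \<Rightarrow> bool"
  where "frechet_holomorphic_on f S \<longleftrightarrow>
    (\<forall>x\<in>S. \<exists>L. Vector_Spaces.linear scaleC scaleC L \<and> (f has_derivative L) (at x))"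

text \<open>As usual in HOL, functions on the unit ball are total functions whose values outside the
  ball are arbitrary; nothing below depends on those values.\<close>

definition holomorphic_ball :: "('a::complex_banach \<Rightarrow> complex) set"
  where "holomorphic_ball = {f. frechet_holomorphic_on f (ball 0 1)}"

definition aut_ball :: "('a::complex_banach \<Rightarrow> 'a) set"
  where "aut_ball = {\<phi>. bij_betw \<phi> (ball 0 1) (ball 0 1) \<and>
    frechet_holomorphic_on \<phi> (ball 0 1) \<and>
    frechet_holomorphic_on (inv_into (ball 0 1) \<phi>) (ball 0 1)}"

section \<open>The two Bloch spaces\<close>

definition norm_nat :: "('a::complex_banach \<Rightarrow> complex) \<Rightarrow> ereal"
  where "norm_nat f =
    (SUP x\<in>ball 0 1. ereal ((1 - (norm x)\<^sup>2) * onorm (frechet_derivative f (at x))))"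

definition norm_inv :: "('a::complex_banach \<Rightarrow> complex) \<Rightarrow> ereal"
  where "norm_inv f =
    (SUP \<phi>\<in>aut_ball. ereal (onorm (frechet_derivative (f \<circ> \<phi>) (at 0))))"

definition bloch_nat :: "('a::complex_banach \<Rightarrow> complex) set"
  where "bloch_nat = {f \<in> holomorphic_ball. norm_nat f < \<infinity>}"

definition bloch_inv :: "('a::complex_banach \<Rightarrow> complex) set"
  where "bloch_inv = {f \<in> holomorphic_ball. norm_inv f < \<infinity>}"

section \<open>The space of pairs of complex numbers with the maximum norm\<close>

text \<open>A separate type is needed because the product type carries the Euclidean norm.\<close>

datatype c2max = C2 (coord1: complex) (coord2: complex)

instantiation c2max :: real_vector
begin

definition "0 = C2 0 0"
definition "x + y = C2 (coord1 x + coord1 y) (coord2 x + coord2 y)"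
definition "x - y = C2 (coord1 x - coord1 y) (coord2 x - coord2 y)"
definition "- x = C2 (- coord1 x) (- coord2 x)"
definition "r *\<^sub>R x = C2 (r *\<^sub>R coord1 x) (r *\<^sub>R coord2 x)"

instance
  by standard (simp_all add: zero_c2max_def plus_c2max_def minus_c2max_def uminus_c2max_def
      scaleR_c2max_def algebra_simps)

end

instantiation c2max :: real_normed_vector
begin

definition "norm x = max (cmod (coord1 x)) (cmod (coord2 x))"
definition "dist x y = norm (x - y)" for x y :: c2max
definition "sgn x = x /\<^sub>R norm x" for x :: c2max
definition "(uniformity :: (c2max \<times> c2max) filter) =
  (INF e\<in>{0<..}. principal {(x, y). dist x y < e})"
definition "open U \<longleftrightarrow> (\<forall>x\<in>U. \<forall>\<^sub>F (x', y) in uniformity. x' = x \<longrightarrow> y \<in> U)"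
  for U :: "c2max set"

lemmas c2max_defs = zero_c2max_def plus_c2max_def minus_c2max_def uminus_c2max_def
  scaleR_c2max_def norm_c2max_def

instance
proof
  fix x y :: c2max and r :: real
  show "norm (x + y) \<le> norm x + norm y"
    using norm_triangle_ineq[of "coord1 x" "coord1 y"] norm_triangle_ineq[of "coord2 x" "coord2 y"]
    unfolding c2max_defs c2max.sel by linarith
  show "norm (r *\<^sub>R x) = \<bar>r\<bar> * norm x"
    by (simp add: c2max_defs max_mult_distrib_left)
  show "norm x = 0 \<longleftrightarrow> x = 0"
    by (cases x) (auto simp: c2max_defs max_def)
qed (simp_all add: dist_c2max_def sgn_c2max_def uniformity_c2max_def open_c2max_def)

end

instance c2max :: banach
proof
  fix X :: "nat \<Rightarrow> c2max"
  assume X: "Cauchy X"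
  have "dist (coord1 x) (coord1 y) \<le> dist x y" "dist (coord2 x) (coord2 y) \<le> dist x y" for x y
    by (simp_all add: dist_norm c2max_defs)
  then have "Cauchy (\<lambda>n. coord1 (X n))" "Cauchy (\<lambda>n. coord2 (X n))"
    using X unfolding Cauchy_def by (meson le_less_trans)+
  then obtain a b where ab: "(\<lambda>n. coord1 (X n)) \<longlonglongrightarrow> a" "(\<lambda>n. coord2 (X n)) \<longlonglongrightarrow> b"
    by (meson Cauchy_convergent convergent_def)
  have "(\<lambda>n. max (cmod (coord1 (X n) - a)) (cmod (coord2 (X n) - b))) \<longlonglongrightarrow> max 0 0"
    using ab by (intro tendsto_max) (auto simp: tendsto_norm_zero_iff LIM_zero)
  then have "(\<lambda>n. dist (X n) (C2 a b)) \<longlonglongrightarrow> 0"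
    by (simp add: dist_norm c2max_defs)
  then show "convergent X"
    using tendsto_dist_iff convergent_def by blast
qed

instantiation c2max :: complex_banach
begin

definition scaleC_c2max :: "complex \<Rightarrow> c2max \<Rightarrow> c2max"
  where "c *\<^sub>C x = C2 (c * coord1 x) (c * coord2 x)"

instance
  by standard (simp_all add: scaleC_c2max_def c2max_defs algebra_simps norm_mult
      scaleR_conv_of_real max_mult_distrib_left)

end

lemma ball_c2max_eq_bidisc:
  "ball (0 :: c2max) 1 = {C2 z w |z w. z \<in> ball 0 1 \<and> w \<in> ball 0 1}"
  by (auto simp: mem_ball_0 norm_c2max_def) (metis c2max.collapse)

end

theory Submission
  imports Defs "HOL-Complex_Analysis.Riemann_Mapping"
begin

text \<open>The automorphisms acting by a Moebius map in each coordinate move \<open>0\<close> to any given point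
  \<open>(a, b)\<close>, with derivative \<open>diag (1 - |a|\<^sup>2, 1 - |b|\<^sup>2)\<close> at \<open>0\<close>. Each diagonal entry is at least
  \<open>1 - \<parallel>(a, b)\<parallel>\<^sup>2\<close>, which gives the inclusion. At \<open>(0, b)\<close> the first entry is \<open>1\<close>, so functions
  in the smaller space have bounded \<open>\<partial>f/\<partial>z\<close> on \<open>{0} \<times> D\<close>, unlike \<open>f(z, w) = z Ln (1 - w)\<close>,
  which lies in the larger space because \<open>w \<mapsto> Ln (1 - w)\<close> is a Bloch function on the disc.\<close>

section \<open>Calculus of maps acting separately in each coordinate\<close>

lemma bounded_linear_coord1: "bounded_linear coord1"
  by (rule bounded_linear_intro[where K = 1]) (simp_all add: c2max_defs)

lemma bounded_linear_coord2: "bounded_linear coord2"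
  by (rule bounded_linear_intro[where K = 1]) (simp_all add: c2max_defs)

lemma has_derivative_C2:
  assumes "(f has_derivative f') F" "(g has_derivative g') F"
  shows "((\<lambda>x. C2 (f x) (g x)) has_derivative (\<lambda>h. C2 (f' h) (g' h))) F"
proof -
  have "bounded_linear (\<lambda>a. C2 a 0)" "bounded_linear (\<lambda>b. C2 0 b)"
    by (rule bounded_linear_intro[where K = 1]; simp add: c2max_defs)+
  from has_derivative_add[OF bounded_linear.has_derivative[OF this(1) assms(1)]
      bounded_linear.has_derivative[OF this(2) assms(2)]]
  show ?thesis
    by (simp add: plus_c2max_def)
qed

lemma has_derivative_coordwise:
  assumes "(p has_field_derivative p') (at (coord1 x))" "(q has_field_derivative q') (at (coord2 x))"
  shows "((\<lambda>x. C2 (p (coord1 x)) (q (coord2 x))) has_derivative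
    (\<lambda>h. C2 (p' * coord1 h) (q' * coord2 h))) (at x)"
proof -
  have "(coord1 has_derivative coord1) (at x)" "(coord2 has_derivative coord2) (at x)"
    by (simp_all add: bounded_linear_imp_has_derivative bounded_linear_coord1 bounded_linear_coord2)
  then show ?thesis
    using assms unfolding has_field_derivative_def
    by (intro has_derivative_C2) (auto intro: has_derivative_compose[where g = p] has_derivative_compose[where g = q])
qed

lemma frechet_holomorphic_on_coordwise:
  assumes "p holomorphic_on ball 0 1" "q holomorphic_on ball 0 1"
  shows "frechet_holomorphic_on (\<lambda>x. C2 (p (coord1 x)) (q (coord2 x))) (ball 0 1)"
  unfolding frechet_holomorphic_on_def
proof
  fix x :: c2max
  assume "x \<in> ball 0 1"
  then have "coord1 x \<in> ball 0 1" "coord2 x \<in> ball 0 1"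
    by (simp_all add: norm_c2max_def)
  with assms obtain p' q' where "(p has_field_derivative p') (at (coord1 x))"
      "(q has_field_derivative q') (at (coord2 x))"
    using holomorphic_derivI open_ball by metis
  note has_derivative_coordwise[OF this]
  moreover have "Vector_Spaces.linear scaleC scaleC (\<lambda>h. C2 (p' * coord1 h) (q' * coord2 h))"
    by (auto simp: Vector_Spaces.linear_iff vector_space_scaleC plus_c2max_def scaleC_c2max_def
        algebra_simps)
  ultimately show "\<exists>L. Vector_Spaces.linear scaleC scaleC L \<and>
      ((\<lambda>x. C2 (p (coord1 x)) (q (coord2 x))) has_derivative L) (at x)"
    by blast
qed

text \<open>Meant for \<open>inv_into\<close>, which is known to agree with the inverse Moebius map
  only on the ball.\<close>

lemma frechet_holomorphic_on_cong:
  assumes "open S" "\<And>x. x \<in> S \<Longrightarrow> f x = g x" "frechet_holomorphic_on f S"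
  shows "frechet_holomorphic_on g S"
  unfolding frechet_holomorphic_on_def
proof
  fix x
  assume x: "x \<in> S"
  with assms(3) obtain L where "Vector_Spaces.linear scaleC scaleC L" "(f has_derivative L) (at x)"
    unfolding frechet_holomorphic_on_def by blast
  then show "\<exists>L. Vector_Spaces.linear scaleC scaleC L \<and> (g has_derivative L) (at x)"
    using has_derivative_transform_within_open[of f _ x UNIV S g] assms(1,2) x by blast
qed

section \<open>Moebius automorphisms of the bidisc\<close>

definition moebius_map :: "c2max \<Rightarrow> c2max \<Rightarrow> c2max"
  where "moebius_map a x = C2 (Moebius_function 0 (- coord1 a) (coord1 x))
    (Moebius_function 0 (- coord2 a) (coord2 x))"

lemma moebius_map_in_ball:
  assumes "a \<in> ball 0 1" "x \<in> ball 0 1"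
  shows "moebius_map a x \<in> ball 0 1"
  using assms by (simp add: moebius_map_def norm_c2max_def Moebius_function_norm_lt_1)

lemma moebius_map_uminus:
  assumes "a \<in> ball 0 1" "x \<in> ball 0 1"
  shows "moebius_map (- a) (moebius_map a x) = x"
  using assms
  by (cases x) (simp add: moebius_map_def norm_c2max_def Moebius_function_compose uminus_c2max_def)

text \<open>The inverse is the map of the same form with parameter \<open>- a\<close>, so holomorphy
  in both directions is a single fact.\<close>

lemma moebius_map_in_aut_ball:
  assumes a: "a \<in> ball 0 1"
  shows "moebius_map a \<in> aut_ball"
proof -
  have a': "- a \<in> ball 0 1"
    using a by simp
  have bij: "bij_betw (moebius_map a) (ball 0 1) (ball 0 1)"
  proof (rule bij_betw_byWitness[where f' = "moebius_map (- a)"])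
    show "\<forall>x\<in>ball 0 1. moebius_map (- a) (moebius_map a x) = x"
      using moebius_map_uminus[OF a] by blast
    show "\<forall>x\<in>ball 0 1. moebius_map a (moebius_map (- a) x) = x"
      using moebius_map_uminus[OF a'] by simp
    show "moebius_map a ` ball 0 1 \<subseteq> ball 0 1" "moebius_map (- a) ` ball 0 1 \<subseteq> ball 0 1"
      using moebius_map_in_ball a a' by blast+
  qed
  have hol: "frechet_holomorphic_on (moebius_map b) (ball 0 1)" if "b \<in> ball 0 1" for b
    using that unfolding moebius_map_def
    by (intro frechet_holomorphic_on_coordwise Moebius_function_holomorphic)
      (simp_all add: norm_c2max_def)
  have "moebius_map (- a) y = inv_into (ball 0 1) (moebius_map a) y" if "y \<in> ball 0 1" for y
    using that moebius_map_uminus[OF a' that] moebius_map_in_ball[OF a' that] bij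
    by (metis bij_betw_imp_inj_on inv_into_f_eq minus_minus)
  then have "frechet_holomorphic_on (inv_into (ball 0 1) (moebius_map a)) (ball 0 1)"
    using frechet_holomorphic_on_cong[OF open_ball _ hol[OF a']] by blast
  then show ?thesis
    using bij hol[OF a] by (simp add: aut_ball_def)
qed

lemma moebius_map_0: "moebius_map a 0 = a"
  by (cases a) (simp add: moebius_map_def Moebius_function_simple zero_c2max_def)

text \<open>The minus sign in the parameter gives z \<mapsto> (z + a) / (1 + cnj a * z), which sends
  0 to \<open>a\<close> instead of \<open>a\<close> to 0.\<close>

lemma Moebius_function_deriv_0:
  "(Moebius_function 0 (- a) has_field_derivative of_real (1 - (cmod a)\<^sup>2)) (at 0)"
proof -
  have "((\<lambda>z. (z + a) / (1 + cnj a * z)) has_field_derivative 1 - a * cnj a) (at 0)"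
    by (auto intro!: derivative_eq_intros)
  then show ?thesis
    by (simp add: Moebius_function_simple[abs_def] flip: complex_norm_square)
qed

lemma moebius_map_has_derivative_0:
  "(moebius_map a has_derivative
    (\<lambda>h. C2 (of_real (1 - (cmod (coord1 a))\<^sup>2) * coord1 h) (of_real (1 - (cmod (coord2 a))\<^sup>2) * coord2 h))) (at 0)"
  using has_derivative_coordwise[of "Moebius_function 0 (- coord1 a)" _ 0
      "Moebius_function 0 (- coord2 a)"] Moebius_function_deriv_0[of "coord1 a"]
    Moebius_function_deriv_0[of "coord2 a"]
  by (simp add: moebius_map_def[abs_def] zero_c2max_def)

text \<open>The chain rule for \<open>f \<circ> moebius_map a\<close> at 0, tested on the vector (z,
  w): this automorphism is one competitor in the supremum. The product is taken in
  \<open>ereal\<close> so that an infinite \<open>norm_inv f\<close> is covered.\<close>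

lemma norm_inv_ge:
  assumes a: "a \<in> ball 0 1" and f: "(f has_derivative L) (at a)"
  shows "ereal (cmod (L (C2 (of_real (1 - (cmod (coord1 a))\<^sup>2) * z) (of_real (1 - (cmod (coord2 a))\<^sup>2) * w))))
    \<le> norm_inv f * ereal (norm (C2 z w))"
proof -
  let ?D = "\<lambda>h. L (C2 (of_real (1 - (cmod (coord1 a))\<^sup>2) * coord1 h) (of_real (1 - (cmod (coord2 a))\<^sup>2) * coord2 h))"
  have D: "(f \<circ> moebius_map a has_derivative ?D) (at 0)"
    using has_derivative_compose[OF moebius_map_has_derivative_0, of f L a] f
    by (simp add: moebius_map_0 comp_def)
  have "ereal (onorm ?D) \<le> norm_inv f"
    unfolding norm_inv_def frechet_derivative_at[OF D]
    by (rule SUP_upper[OF moebius_map_in_aut_ball[OF a]])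
  then have *: "ereal (onorm ?D) * ereal (norm (C2 z w)) \<le> norm_inv f * ereal (norm (C2 z w))"
    by (rule ereal_mult_right_mono) simp
  have "ereal (cmod (?D (C2 z w))) \<le> ereal (onorm ?D) * ereal (norm (C2 z w))"
    using onorm[OF has_derivative_bounded_linear[OF D], of "C2 z w"]
    by (simp only: times_ereal.simps ereal_less_eq)
  from order_trans[OF this *] show ?thesis
    by (simp only: c2max.sel)
qed

section \<open>The inclusion: comparison of the two seminorms\<close>

lemma norm_nat_le_norm_inv:
  fixes f :: "c2max \<Rightarrow> complex"
  assumes "f \<in> holomorphic_ball"
  shows "norm_nat f \<le> norm_inv f"
  unfolding norm_nat_def
proof (rule SUP_least)
  fix a :: c2max
  assume a: "a \<in> ball 0 1"
  with assms obtain L where L: "(f has_derivative L) (at a)"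
    unfolding holomorphic_ball_def frechet_holomorphic_on_def by blast
  define s where "s = 1 - (norm a)\<^sup>2"
  define s1 where "s1 = 1 - (cmod (coord1 a))\<^sup>2"
  define s2 where "s2 = 1 - (cmod (coord2 a))\<^sup>2"
  have "0 < s"
    using a by (simp add: s_def abs_square_less_1)
  moreover have "s \<le> s1" "s \<le> s2"
    by (simp_all add: s_def s1_def s2_def norm_c2max_def power_mono)
  ultimately have s: "0 < s" "s \<le> s1" "s \<le> s2" .
  show "ereal ((1 - (norm a)\<^sup>2) * onorm (frechet_derivative f (at a))) \<le> norm_inv f"
  proof (cases "norm_inv f")
    case (real M)
    \<comment> \<open>Testing on the unit vector (1, 0) bounds a norm by \<open>M\<close>.\<close>
    have M: "0 \<le> M"
      using norm_inv_ge[OF a L, of 1 0] order_trans[OF norm_ge_zero, of _ M]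
      by (simp add: real norm_c2max_def)
    have le: "cmod (L u) \<le> M / s * norm u" for u
    proof -
      obtain z w where u: "u = C2 z w"
        by (cases u)
      \<comment> \<open>The diagonal derivative \<open>diag (s1, s2)\<close> is undone: it carries
        (z / s1, w / s2) to \<open>u\<close>. Since \<open>s\<close> is the smaller entry, this
        costs at most a factor \<open>1 / s\<close>.\<close>
      have "cmod (L u) \<le> M * norm (C2 (z / s1) (w / s2))"
        using norm_inv_ge[OF a L, of "z / s1" "w / s2"] s
        by (simp add: u real s1_def[symmetric] s2_def[symmetric] del: of_real_diff)
      also have "norm (C2 (z / s1) (w / s2)) \<le> norm u / s"
        using s by (auto simp: u norm_c2max_def norm_divide le_max_iff_disj intro!: frac_le)
      finally show ?thesis
        using M by (simp add: mult_left_mono)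
    qed
    have "onorm L \<le> M / s"
      using le M s by (intro onorm_bound) simp_all
    then show ?thesis
      using s by (simp add: real frechet_derivative_at[OF L, symmetric] s_def[symmetric] field_simps)
  next
    case MInf
    \<comment> \<open>Impossible case: a nonnegative number would lie below minus infinity.\<close>
    show ?thesis
      using norm_inv_ge[OF a L, of 1 0] by (simp add: MInf norm_c2max_def)
  qed simp
qed

section \<open>Strictness: the function z Ln (1 - w)\<close>

lemma norm_Ln_le_ln_norm:
  assumes "u \<noteq> 0"
  shows "cmod (Ln u) \<le> \<bar>ln (cmod u)\<bar> + pi"
  using cmod_le[of "Ln u"] Re_Ln[OF assms] mpi_less_Im_Ln[OF assms] Im_Ln_le_pi[OF assms] by simp

abbreviation z_Ln :: "c2max \<Rightarrow> complex"
  where "z_Ln x \<equiv> coord1 x * Ln (1 - coord2 x)"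

lemma z_Ln_has_derivative:
  assumes "x \<in> ball 0 1"
  shows "(z_Ln has_derivative
    (\<lambda>h. coord1 h * Ln (1 - coord2 x) - coord1 x * coord2 h / (1 - coord2 x))) (at x)"
proof -
  have "cmod (coord2 x) < 1"
    using assms by (simp add: norm_c2max_def)
  \<comment> \<open>The real part is positive, so the branch cut of \<open>Ln\<close> is
    avoided.\<close>
  then have "1 - coord2 x \<notin> \<real>\<^sub>\<le>\<^sub>0"
    using complex_Re_le_cmod[of "coord2 x"] by (auto simp: complex_nonpos_Reals_iff)
  then have "((\<lambda>w. Ln (1 - w)) has_field_derivative - 1 / (1 - coord2 x)) (at (coord2 x))"
    by (auto intro!: derivative_eq_intros simp: divide_inverse)
  then have "((\<lambda>x. Ln (1 - coord2 x)) has_derivative (\<lambda>h. - 1 / (1 - coord2 x) * coord2 h)) (at x)"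
    unfolding has_field_derivative_def
    using has_derivative_compose[OF bounded_linear_imp_has_derivative[OF bounded_linear_coord2]]
    by blast
  from has_derivative_mult[OF bounded_linear_imp_has_derivative[OF bounded_linear_coord1] this]
  show ?thesis
    by (simp add: algebra_simps)
qed

text \<open>With r = |w|, both partial derivatives are O(1 / (1 - r)): the logarithm contributes
  \<open>pi + 1\<close>, the quotient 1. The weight is at most \<open>2 * (1 - r)\<close>, whence
  the bound \<open>2 * (pi + 2)\<close>.\<close>

lemma z_Ln_in_bloch_nat: "z_Ln \<in> bloch_nat"
proof -
  have "z_Ln \<in> holomorphic_ball"
    unfolding holomorphic_ball_def frechet_holomorphic_on_def mem_Collect_eq
  proof
    fix x :: c2max
    assume "x \<in> ball 0 1"
    note z_Ln_has_derivative[OF this]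
    moreover have "Vector_Spaces.linear scaleC scaleC
        (\<lambda>h. coord1 h * Ln (1 - coord2 x) - coord1 x * coord2 h / (1 - coord2 x))"
      by (auto simp: Vector_Spaces.linear_iff vector_space_scaleC plus_c2max_def scaleC_c2max_def
          scaleC_complex_def[THEN fun_cong, THEN fun_cong] algebra_simps add_divide_distrib)
    ultimately show "\<exists>L. Vector_Spaces.linear scaleC scaleC L \<and> (z_Ln has_derivative L) (at x)"
      by blast
  qed
  moreover have "norm_nat z_Ln \<le> ereal (2 * (pi + 2))"
    unfolding norm_nat_def
  proof (rule SUP_least)
    fix x :: c2max
    assume x: "x \<in> ball 0 1"
    let ?L = "\<lambda>h. coord1 h * Ln (1 - coord2 x) - coord1 x * coord2 h / (1 - coord2 x)"
    define r where "r = cmod (coord2 x)"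
    define u where "u = 1 - coord2 x"
    have r: "0 \<le> r" "r < 1" "r \<le> norm x" and x1: "cmod (coord1 x) \<le> 1"
      using x by (simp_all add: r_def norm_c2max_def)
    have u: "1 - r \<le> cmod u" "cmod u \<le> 2"
      using norm_triangle_ineq2[of 1 "coord2 x"] norm_triangle_ineq4[of 1 "coord2 x"] r
      by (simp_all add: u_def r_def)
    then have u0: "0 < cmod u"
      using r by linarith
    have inv_u: "1 / cmod u \<le> 1 / (1 - r)"
      using u r by (simp add: frac_le)
    have "ln (cmod u) \<le> 1"
      using ln_le_minus_one[OF u0] u by linarith
    \<comment> \<open>A crude bound suffices, as the other partial derivative already grows like
      \<open>1 / cmod u\<close>.\<close>
    moreover have "- ln (cmod u) \<le> 1 / cmod u - 1"
      using ln_le_minus_one[of "1 / cmod u"] u0 by (simp add: ln_div)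
    moreover have "1 \<le> 1 / (1 - r)"
      using r by simp
    ultimately have "\<bar>ln (cmod u)\<bar> \<le> 1 / (1 - r)"
      using inv_u by linarith
    moreover have "pi \<le> pi / (1 - r)"
      using r by (simp add: le_divide_eq)
    ultimately have Ln_u: "cmod (Ln u) \<le> (pi + 1) / (1 - r)"
      using norm_Ln_le_ln_norm[of u] u0 by (simp add: add_divide_distrib)
    have "cmod (?L h) \<le> (pi + 2) / (1 - r) * norm h" for h
    proof -
      have h: "cmod (coord1 h) \<le> norm h" "cmod (coord2 h) \<le> norm h"
        by (simp_all add: norm_c2max_def)
      have "cmod (?L h) \<le> cmod (coord1 h) * cmod (Ln u) + cmod (coord1 x) * cmod (coord2 h) * (1 / cmod u)"
        using norm_triangle_ineq4[of "coord1 h * Ln u" "coord1 x * coord2 h / u"]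
        by (simp add: norm_divide norm_mult u_def)
      also have "\<dots> \<le> norm h * ((pi + 1) / (1 - r)) + 1 * norm h * (1 / (1 - r))"
        using h x1 inv_u Ln_u r
        by (intro add_mono mult_mono) auto
      also have "\<dots> = (pi + 2) / (1 - r) * norm h"
        by (simp add: add_divide_distrib algebra_simps)
      finally show ?thesis .
    qed
    then have "onorm ?L \<le> (pi + 2) / (1 - r)"
      using r by (intro onorm_bound) simp_all
    moreover have "1 - (norm x)\<^sup>2 \<le> 2 * (1 - r)"
    proof -
      have "r\<^sup>2 \<le> (norm x)\<^sup>2"
        using r by (simp add: power_mono)
      \<comment> \<open>Expanded, this says \<open>1 - r\<^sup>2 \<le> 2 * (1 - r)\<close>.\<close>
      moreover have "0 \<le> (1 - r)\<^sup>2"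
        by simp
      ultimately show ?thesis
        by (simp add: power2_eq_square algebra_simps)
    qed
    moreover have "0 \<le> onorm ?L"
      by (rule onorm_pos_le[OF has_derivative_bounded_linear[OF z_Ln_has_derivative[OF x]]])
    ultimately have "(1 - (norm x)\<^sup>2) * onorm ?L \<le> 2 * (1 - r) * ((pi + 2) / (1 - r))"
      using r by (intro mult_mono) auto
    also have "\<dots> = 2 * (pi + 2)"
      using r by (simp add: divide_simps algebra_simps)
    finally show "ereal ((1 - (norm x)\<^sup>2) * onorm (frechet_derivative z_Ln (at x))) \<le> ereal (2 * (pi + 2))"
      by (simp add: frechet_derivative_at[OF z_Ln_has_derivative[OF x], symmetric])
  qed
  ultimately show ?thesis
    by (auto simp: bloch_nat_def less_top[symmetric] top_ereal_def)
qed

lemma norm_inv_z_Ln: "norm_inv z_Ln = \<infinity>"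
proof (rule ereal_top)
  fix B :: real
  \<comment> \<open>Chosen so that \<open>Ln t\<close> has modulus |B|; the absolute value ensures
    \<open>t \<le> 1\<close>, which keeps \<open>a\<close> in the ball.\<close>
  define t :: real where "t = exp (- \<bar>B\<bar>)"
  define a where "a = C2 0 (1 - complex_of_real t)"
  have t: "0 < t" "t \<le> 1"
    by (simp_all add: t_def)
  have a: "a \<in> ball 0 1"
    using t norm_of_real[of "1 - t", where 'a = complex] by (simp add: a_def norm_c2max_def)
  have "B \<le> cmod (Ln (complex_of_real t))"
    by (simp add: t_def Ln_of_real)
  also have "ereal (cmod (Ln (complex_of_real t))) \<le> norm_inv z_Ln"
    \<comment> \<open>In direction (1, 0) the diagonal entry is 1 because
      \<open>coord1 a = 0\<close>, so the derivative is \<open>Ln t\<close> without any damping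
      factor.\<close>
    using norm_inv_ge[OF a z_Ln_has_derivative[OF a], of 1 0]
    by (simp add: a_def norm_c2max_def)
  finally show "ereal B \<le> norm_inv z_Ln"
    by simp
qed

theorem proposition2p5:
  "(bloch_inv :: (c2max \<Rightarrow> complex) set) \<subset> bloch_nat"
proof
  show "(bloch_inv :: (c2max \<Rightarrow> complex) set) \<subseteq> bloch_nat"
    using norm_nat_le_norm_inv by (force simp: bloch_inv_def bloch_nat_def intro: le_less_trans)
  show "(bloch_inv :: (c2max \<Rightarrow> complex) set) \<noteq> bloch_nat"
    using z_Ln_in_bloch_nat norm_inv_z_Ln by (auto simp: bloch_inv_def)
qed

end
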